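(* Let $n,k$ be positive integers with $n\geq k+2$, let $\mathcal{V}=(\mathbb{F}^n)^{\otimes k}$, let $\widehat\rho: S_n\to\mathrm{GL}(\mathcal{V})$ be the canonical representation defined by $(\widehat\rho(\pi)x)_I = x_{\pi^{-1}(I)}$ for every multi-index $I\in[n]^k$, and let $\rho=\Pi_{\mathrm{GL}(\mathcal{V})}\circ\widehat\rho: S_n\to\mathrm{PGL}(\mathcal{V})$ be its projection. Then the projective invariance problem for $\rho$ is equivalent to the linear invariance problem for $\widehat\rho$: for every nonzero $x\in\mathcal{V}$ with class $v\in\mathrm{P}(\mathcal{V})$, one has $\rho(\pi)v=v$ in $\mathrm{P}(\mathcal{V})$ for all $\pi\in S_n$ if and only if $\widehat\rho(\pi)x=x$ in $\mathcal{V}$ for all $\pi\in S_n$.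
   Context: $\mathbb{F}$ denotes $\mathbb{R}$ or $\mathbb{C}$. $[n]=\{0,1,\dots,n-1\}$ and $S_n$ is the group of permutations of $[n]$, acting on multi-indices entrywise: $\pi(i_0,\dots,i_{k-1})=(\pi(i_0),\dots,\pi(i_{k-1}))$. Elements of $(\mathbb{F}^n)^{\otimes k}$ are identified with arrays $(x_I)_{I\in[n]^k}$ of scalars. $\mathrm{P}(\mathcal{V})$ is the set of equivalence classes of $\mathcal{V}\setminus\{0\}$ under multiplication by nonzero scalars, $\mathrm{PGL}(\mathcal{V})$ is $\mathrm{GL}(\mathcal{V})$ modulo nonzero scalar multiples of the identity, and $\Pi_{\mathrm{GL}(\mathcal{V})}$ is the projection $\mathrm{GL}(\mathcal{V})\to\mathrm{PGL}(\mathcal{V})$. *)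

theory Defs
  imports "HOL-Analysis.Analysis" "HOL-Combinatorics.Permutations"
    "HOL-Algebra.Coset" "HOL-Algebra.Bij"
begin

section \<open>Projective spaces and projective linear groups\<close>

text \<open>
  Vector spaces are coordinate spaces over a field, with index type \<open>'i\<close>.
\<close>

definition GL :: "('f::field ^ 'i::finite \<Rightarrow> 'f ^ 'i) monoid" where
  "GL = \<lparr>carrier = {g. Vector_Spaces.linear (*s) (*s) g \<and> bij g}, monoid.mult = (\<circ>), one = id\<rparr>"

definition scalar_maps :: "('f::field ^ 'i::finite \<Rightarrow> 'f ^ 'i) set" where
  "scalar_maps = {(\<lambda>x. c *s x) | c. c \<noteq> 0}"

definition PGL :: "('f::field ^ 'i::finite \<Rightarrow> 'f ^ 'i) set monoid" where
  "PGL = GL Mod scalar_maps"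

definition proj_GL :: "('f::field ^ 'i::finite \<Rightarrow> 'f ^ 'i) \<Rightarrow> ('f ^ 'i \<Rightarrow> 'f ^ 'i) set" where
  "proj_GL g = scalar_maps #>\<^bsub>GL\<^esub> g"

definition proj_rel :: "('f::field ^ 'i::finite) rel" where
  "proj_rel = {(x, y). x \<noteq> 0 \<and> y \<noteq> 0 \<and> (\<exists>c. c \<noteq> 0 \<and> y = c *s x)}"

definition proj_space :: "('f::field ^ 'i::finite) set set" where
  "proj_space = (UNIV - {0}) // proj_rel"

definition proj_class :: "'f::field ^ 'i::finite \<Rightarrow> ('f ^ 'i) set" where
  "proj_class x = proj_rel `` {x}"

text \<open>
  The action of an element \<open>C\<close> of PGL on a point \<open>v\<close> of projective space; both are sets of
  representatives. Lemma \<open>proj_act_proj_class\<close> below shows that this is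
  the action induced by \<open>(g, x) \<mapsto> g x\<close>.
\<close>

definition proj_act :: "('f::field ^ 'i::finite \<Rightarrow> 'f ^ 'i) set \<Rightarrow> ('f ^ 'i) set \<Rightarrow> ('f ^ 'i) set" where
  "proj_act C v = {g y | g y. g \<in> C \<and> y \<in> v}"

section \<open>The permutation representation on tensors\<close>

text \<open>
  An order-\<open>k\<close> tensor over \<open>F\<^sup>n\<close> is an array indexed by multi-indices; a multi-index is
  a function \<open>I :: 'k \<Rightarrow> 'n\<close> with \<open>k = CARD('k)\<close> and \<open>n = CARD('n)\<close>, and a permutation \<open>\<pi>\<close> of
  \<open>'n\<close> acts on it entrywise, by \<open>\<pi> \<circ> I\<close>.
\<close>

definition perm_rep :: "('n \<Rightarrow> 'n) \<Rightarrow> 'f::field ^ ('k::finite \<Rightarrow> 'n::finite) \<Rightarrow> 'f ^ ('k \<Rightarrow> 'n)" where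
  "perm_rep \<pi> x = (\<chi> I. x $ (Hilbert_Choice.inv \<pi> \<circ> I))"

definition proj_perm_rep ::
    "('n \<Rightarrow> 'n) \<Rightarrow> ('f::field ^ ('k::finite \<Rightarrow> 'n::finite) \<Rightarrow> 'f ^ ('k \<Rightarrow> 'n)) set" where
  "proj_perm_rep = proj_GL \<circ> perm_rep"

section \<open>Well-definedness\<close>

lemma linear_vecI:
  fixes g :: "'f::field ^ 'i::finite \<Rightarrow> 'f ^ 'i"
  assumes "\<And>x y. g (x + y) = g x + g y" "\<And>c x. g (c *s x) = c *s g x"
  shows "Vector_Spaces.linear (*s) (*s) g"
  using assms by unfold_locales auto

lemma carrier_GL_iff:
  "g \<in> carrier GL \<longleftrightarrow>
    (\<forall>x y. g (x + y) = g x + g y) \<and> (\<forall>c x. g (c *s x) = c *s g x) \<and> bij g"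
  unfolding GL_def
  by (auto intro: linear_vecI simp: vec.linear_add vec.linear_scale)

lemma inv_in_GL:
  assumes "g \<in> carrier GL"
  shows "Hilbert_Choice.inv g \<in> carrier GL"
proof -
  have b: "bij g" and a: "\<And>x y. g (x + y) = g x + g y" and s: "\<And>c x. g (c *s x) = c *s g x"
    using assms by (auto simp: carrier_GL_iff)
  have gi: "g (Hilbert_Choice.inv g x) = x" for x
    using b by (simp add: bij_is_surj surj_f_inv_f)
  have ig: "Hilbert_Choice.inv g (g x) = x" for x
    using b by (simp add: bij_is_inj)
  have "Hilbert_Choice.inv g (x + y) = Hilbert_Choice.inv g x + Hilbert_Choice.inv g y" for x y
    by (metis a gi ig)
  moreover have "Hilbert_Choice.inv g (c *s x) = c *s Hilbert_Choice.inv g x" for c x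
    by (metis s gi ig)
  ultimately show ?thesis
    using b by (simp add: carrier_GL_iff bij_imp_bij_inv)
qed

lemma group_GL: "group (GL :: ('f::field ^ 'i::finite \<Rightarrow> 'f ^ 'i) monoid)"
proof (rule groupI)
  fix g :: "'f ^ 'i \<Rightarrow> 'f ^ 'i"
  assume g: "g \<in> carrier GL"
  then have "Hilbert_Choice.inv g \<otimes>\<^bsub>GL\<^esub> g = \<one>\<^bsub>GL\<^esub>"
    by (auto simp: GL_def bij_is_inj)
  then show "\<exists>h\<in>carrier GL. h \<otimes>\<^bsub>GL\<^esub> g = \<one>\<^bsub>GL\<^esub>"
    using inv_in_GL[OF g] by blast
next
  fix g h :: "'f ^ 'i \<Rightarrow> 'f ^ 'i"
  assume "g \<in> carrier GL" "h \<in> carrier GL"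
  moreover have "g \<otimes>\<^bsub>GL\<^esub> h = g \<circ> h"
    by (simp add: GL_def)
  ultimately show "g \<otimes>\<^bsub>GL\<^esub> h \<in> carrier GL"
    by (simp add: carrier_GL_iff bij_comp)
next
  show "\<one>\<^bsub>GL\<^esub> \<in> carrier (GL :: ('f ^ 'i \<Rightarrow> 'f ^ 'i) monoid)"
    unfolding carrier_GL_iff by (simp add: GL_def)
qed (auto simp: GL_def o_assoc)

lemma scalar_map_in_GL:
  fixes c :: "'f::field"
  assumes "c \<noteq> 0"
  shows "(\<lambda>x :: 'f ^ 'i::finite. c *s x) \<in> carrier GL"
proof -
  have "bij (\<lambda>x :: 'f ^ 'i. c *s x)"
    by (rule o_bij[where g = "\<lambda>x. inverse c *s x"]) (use assms in \<open>auto simp: fun_eq_iff\<close>)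
  then show ?thesis
    by (simp add: carrier_GL_iff vec.scale_right_distrib mult.commute)
qed

lemma normal_scalar_maps:
  "scalar_maps \<lhd> (GL :: ('f::field ^ 'i::finite \<Rightarrow> 'f ^ 'i) monoid)"
proof -
  interpret G: group "GL :: ('f ^ 'i \<Rightarrow> 'f ^ 'i) monoid" by (rule group_GL)
  have mult: "g \<otimes>\<^bsub>GL\<^esub> h = g \<circ> h" for g h :: "'f ^ 'i \<Rightarrow> 'f ^ 'i"
    by (simp add: GL_def)
  have one: "\<one>\<^bsub>GL\<^esub> = (id :: 'f ^ 'i \<Rightarrow> 'f ^ 'i)"
    by (simp add: GL_def)
  have sub: "(scalar_maps :: ('f ^ 'i \<Rightarrow> 'f ^ 'i) set) \<subseteq> carrier GL"
    by (auto simp: scalar_maps_def intro: scalar_map_in_GL)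
  have central: "g \<otimes>\<^bsub>GL\<^esub> h = h \<otimes>\<^bsub>GL\<^esub> g"
    if "g \<in> carrier GL" "h \<in> scalar_maps" for g h :: "'f ^ 'i \<Rightarrow> 'f ^ 'i"
    using that by (auto simp: mult scalar_maps_def carrier_GL_iff)
  have "subgroup (scalar_maps :: ('f ^ 'i \<Rightarrow> 'f ^ 'i) set) GL"
  proof (rule G.subgroupI)
    show "(scalar_maps :: ('f ^ 'i \<Rightarrow> 'f ^ 'i) set) \<noteq> {}"
      unfolding scalar_maps_def by (auto intro: exI[of _ 1])
  next
    fix h :: "'f ^ 'i \<Rightarrow> 'f ^ 'i"
    assume h: "h \<in> scalar_maps"
    then obtain c where c: "c \<noteq> 0" "h = (\<lambda>x. c *s x)"
      by (auto simp: scalar_maps_def)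
    have m: "(\<lambda>x. inverse c *s x) \<in> (scalar_maps :: ('f ^ 'i \<Rightarrow> 'f ^ 'i) set)"
      using c by (auto simp: scalar_maps_def intro!: exI[of _ "inverse c"])
    have "(\<lambda>x. inverse c *s x) \<otimes>\<^bsub>GL\<^esub> h = \<one>\<^bsub>GL\<^esub>"
      using c by (auto simp: mult one fun_eq_iff)
    then have "inv\<^bsub>GL\<^esub> h = (\<lambda>x. inverse c *s x)"
      using G.inv_equality m h sub by blast
    then show "inv\<^bsub>GL\<^esub> h \<in> scalar_maps"
      using m by simp
  next
    fix g h :: "'f ^ 'i \<Rightarrow> 'f ^ 'i"
    assume "g \<in> scalar_maps" "h \<in> scalar_maps"
    then obtain c d where "c \<noteq> 0" "d \<noteq> 0" "g = (\<lambda>x. c *s x)" "h = (\<lambda>x. d *s x)"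
      by (auto simp: scalar_maps_def)
    then show "g \<otimes>\<^bsub>GL\<^esub> h \<in> scalar_maps"
      by (auto simp: mult scalar_maps_def fun_eq_iff intro!: exI[of _ "c * d"])
  qed (rule sub)
  moreover have "g \<otimes>\<^bsub>GL\<^esub> h \<otimes>\<^bsub>GL\<^esub> inv\<^bsub>GL\<^esub> g \<in> scalar_maps"
    if "g \<in> carrier GL" "h \<in> scalar_maps" for g h :: "'f ^ 'i \<Rightarrow> 'f ^ 'i"
  proof -
    have "h \<in> carrier GL" using that sub by blast
    then have "g \<otimes>\<^bsub>GL\<^esub> h \<otimes>\<^bsub>GL\<^esub> inv\<^bsub>GL\<^esub> g = h"
      using that central[OF that] by (simp add: G.m_assoc)
    then show ?thesis using that by simp
  qed
  ultimately show ?thesis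
    by (simp add: G.normal_inv_iff)
qed

lemma proj_GL_hom: "proj_GL \<in> hom GL PGL"
  using normal.r_coset_hom_Mod[OF normal_scalar_maps]
  by (simp add: PGL_def proj_GL_def[abs_def])

lemma equiv_proj_rel: "equiv (UNIV - {0}) proj_rel"
proof (rule equivI)
  show "refl_on (UNIV - {0}) (proj_rel :: ('a ^ 'b) rel)"
    by (auto simp: refl_on_def proj_rel_def intro!: exI[of _ 1])
  show "sym (proj_rel :: ('a ^ 'b) rel)"
  proof (rule symI)
    fix x y :: "'a ^ 'b"
    assume "(x, y) \<in> proj_rel"
    then obtain c where "x \<noteq> 0" "y \<noteq> 0" "c \<noteq> 0" "y = c *s x"
      by (auto simp: proj_rel_def)
    then show "(y, x) \<in> proj_rel"
      by (auto simp: proj_rel_def intro!: exI[of _ "inverse c"])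
  qed
  show "trans (proj_rel :: ('a ^ 'b) rel)"
  proof (rule transI)
    fix x y z :: "'a ^ 'b"
    assume "(x, y) \<in> proj_rel" "(y, z) \<in> proj_rel"
    then obtain c d where "x \<noteq> 0" "z \<noteq> 0" "c \<noteq> 0" "y = c *s x" "d \<noteq> 0" "z = d *s y"
      by (auto simp: proj_rel_def)
    then show "(x, z) \<in> proj_rel"
      by (auto simp: proj_rel_def intro!: exI[of _ "d * c"])
  qed
qed (auto simp: proj_rel_def)

lemma proj_class_in_proj_space: "x \<noteq> 0 \<Longrightarrow> proj_class x \<in> proj_space"
  by (auto simp: proj_class_def proj_space_def quotient_def)

lemma proj_act_proj_class:
  fixes g :: "'f::field ^ 'i::finite \<Rightarrow> 'f ^ 'i"
  assumes g: "g \<in> carrier GL" and x: "x \<noteq> 0"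
  shows "proj_act (proj_GL g) (proj_class x) = proj_class (g x)"
proof -
  have s: "\<And>c x. g (c *s x) = c *s g x" and b: "bij g"
    using g by (auto simp: carrier_GL_iff)
  have "g 0 = 0"
    using s[of 0 0] by simp
  then have gx: "g x \<noteq> 0"
    using x b by (metis bij_pointE)
  have cosets: "proj_GL g = {(\<lambda>y. c *s g y) | c. c \<noteq> 0}"
    by (auto simp: proj_GL_def r_coset_def scalar_maps_def GL_def comp_def)
  have cls: "proj_class y = {c *s y | c. c \<noteq> 0}" if "y \<noteq> 0" for y :: "'f ^ 'i"
    using that by (auto simp: proj_class_def proj_rel_def)
  show ?thesis
  proof (intro subset_antisym subsetI)
    fix z assume "z \<in> proj_act (proj_GL g) (proj_class x)"
    then obtain c d where "c \<noteq> 0" "d \<noteq> 0" "z = c *s g (d *s x)"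
      by (auto simp: proj_act_def cosets cls[OF x])
    then show "z \<in> proj_class (g x)"
      by (auto simp: cls[OF gx] s intro!: exI[of _ "c * d"])
  next
    fix z assume "z \<in> proj_class (g x)"
    then obtain c where c: "c \<noteq> 0" "z = c *s g x"
      by (auto simp: cls[OF gx])
    then have "(\<lambda>y. c *s g y) \<in> proj_GL g"
      by (auto simp: cosets)
    moreover have "x \<in> proj_class x"
      by (auto simp: cls[OF x] intro!: exI[of _ 1])
    ultimately show "z \<in> proj_act (proj_GL g) (proj_class x)"
      using c unfolding proj_act_def mem_Collect_eq
      by (intro exI[of _ "\<lambda>y. c *s g y"] exI[of _ x]) simp
  qed
qed

lemma perm_rep_hom:
  "perm_rep \<in> hom (BijGroup (UNIV :: 'n::finite set))
     (GL :: ('f::field ^ ('k::finite \<Rightarrow> 'n) \<Rightarrow> 'f ^ ('k \<Rightarrow> 'n)) monoid)"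
proof (rule homI)
  fix p :: "'n \<Rightarrow> 'n"
  assume "p \<in> carrier (BijGroup UNIV)"
  then have p: "bij p" by (simp add: BijGroup_def Bij_def)
  have "Hilbert_Choice.inv p \<circ> (p \<circ> I) = I" "p \<circ> (Hilbert_Choice.inv p \<circ> I) = I" for I :: "'k \<Rightarrow> 'n"
    using p by (auto simp: fun_eq_iff bij_is_inj bij_is_surj surj_f_inv_f)
  then have "perm_rep (Hilbert_Choice.inv p) \<circ> perm_rep p = (id :: 'f ^ ('k \<Rightarrow> 'n) \<Rightarrow> _)"
    "perm_rep p \<circ> perm_rep (Hilbert_Choice.inv p) = (id :: 'f ^ ('k \<Rightarrow> 'n) \<Rightarrow> _)"
    unfolding perm_rep_def comp_apply fun_eq_iff[of "_ \<circ> _" id] vec_eq_iff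
    by (simp_all only: inv_inv_eq[OF p] vec_lambda_beta id_apply simp_thms)
  then have "bij (perm_rep p :: 'f ^ ('k \<Rightarrow> 'n) \<Rightarrow> 'f ^ ('k \<Rightarrow> 'n))"
    by (rule o_bij)
  then show "(perm_rep p :: 'f ^ ('k \<Rightarrow> 'n) \<Rightarrow> 'f ^ ('k \<Rightarrow> 'n)) \<in> carrier GL"
    by (auto simp: carrier_GL_iff perm_rep_def vec_eq_iff)
next
  fix p q :: "'n \<Rightarrow> 'n"
  assume "p \<in> carrier (BijGroup UNIV)" "q \<in> carrier (BijGroup UNIV)"
  then have "bij p" "bij q" and "p \<otimes>\<^bsub>BijGroup UNIV\<^esub> q = p \<circ> q"
    by (auto simp: BijGroup_def Bij_def compose_def fun_eq_iff)
  moreover from this have "Hilbert_Choice.inv (p \<circ> q) = Hilbert_Choice.inv q \<circ> Hilbert_Choice.inv p"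
    by (intro o_inv_distrib)
  ultimately show "(perm_rep (p \<otimes>\<^bsub>BijGroup UNIV\<^esub> q) :: 'f ^ ('k \<Rightarrow> 'n) \<Rightarrow> _) =
      perm_rep p \<otimes>\<^bsub>GL\<^esub> perm_rep q"
    by (auto simp only: GL_def perm_rep_def vec_eq_iff vec_lambda_beta comp_assoc comp_apply
        monoid.simps intro!: ext)
qed

end

theory Submission
  imports Defs
begin

text \<open>
  If every permutation scales \<open>x\<close>, then a transposition of two values missed by a multi-index \<open>I\<close>
  with \<open>x $ I \<noteq> 0\<close> scales \<open>x\<close> by \<open>1\<close>; two such values exist because \<open>n \<ge> k + 2\<close>. The scaling factor
  is invariant under conjugation, so all transpositions fix \<open>x\<close>, and they generate the symmetric group.
\<close>

lemma permutes_UNIV_iff_bij: "p permutes (UNIV :: 'n set) \<longleftrightarrow> bij p"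
  using bij_imp_permutes[of p UNIV] permutes_bij by auto

lemma perm_rep_in_GL:
  assumes "p permutes (UNIV :: 'n::finite set)"
  shows "(perm_rep p :: 'f::field ^ ('k::finite \<Rightarrow> 'n) \<Rightarrow> _) \<in> carrier GL"
  using assms hom_in_carrier[OF perm_rep_hom, of p]
  by (simp add: BijGroup_def Bij_def permutes_UNIV_iff_bij)

text \<open>Inverting a composite reverses its factors and precomposing with it reverses them again,
  so the order of \<open>p\<close> and \<open>q\<close> is kept.\<close>

lemma perm_rep_comp:
  fixes x :: "'f::field ^ ('k::finite \<Rightarrow> 'n::finite)"
  assumes "p permutes UNIV" "q permutes UNIV"
  shows "perm_rep (p \<circ> q) x = perm_rep p (perm_rep q x)"
  using assms o_inv_distrib[of p q]
  by (simp add: permutes_UNIV_iff_bij perm_rep_def comp_assoc)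

lemma perm_rep_id: "perm_rep id x = x"
  by (simp add: perm_rep_def vec_eq_iff inv_id del: id_apply)

lemma perm_rep_scale: "perm_rep p (c *s x) = c *s perm_rep p x"
  by (simp add: perm_rep_def vec_eq_iff)

lemma proj_class_eq_iff:
  assumes "x \<noteq> 0" "y \<noteq> 0"
  shows "proj_class y = proj_class x \<longleftrightarrow> (\<exists>c. c \<noteq> 0 \<and> y = c *s x)"
proof -
  have "proj_class x = proj_class y \<longleftrightarrow> (x, y) \<in> proj_rel"
    unfolding proj_class_def using eq_equiv_class_iff[OF equiv_proj_rel] assms by simp
  then show ?thesis
    using assms by (auto simp: proj_rel_def)
qed

text \<open>Reduces projective invariance to an eigenvector condition. Injectivity of
  \<open>perm_rep p\<close> keeps the image of \<open>x\<close> nonzero, so equality of the two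
  classes means proportionality.\<close>

lemma proj_perm_rep_fixes_iff:
  fixes x :: "'f::field ^ ('k::finite \<Rightarrow> 'n::finite)"
  assumes p: "p permutes UNIV" and x: "x \<noteq> 0"
  shows "proj_act (proj_perm_rep p) (proj_class x) = proj_class x \<longleftrightarrow>
    (\<exists>c. c \<noteq> 0 \<and> perm_rep p x = c *s x)"
proof -
  have inj: "inj (perm_rep p :: 'f ^ ('k \<Rightarrow> 'n) \<Rightarrow> _)"
    using perm_rep_in_GL[OF p, where 'f = 'f and 'k = 'k] by (simp add: carrier_GL_iff bij_is_inj)
  have "perm_rep p 0 = (0 :: 'f ^ ('k \<Rightarrow> 'n))"
    by (simp add: perm_rep_def vec_eq_iff)
  then have "perm_rep p x \<noteq> 0"
    using injD[OF inj, of x 0] x by auto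
  with x show ?thesis
    by (simp add: proj_perm_rep_def proj_act_proj_class[OF perm_rep_in_GL[OF p] x] proj_class_eq_iff)
qed

text \<open>The range has at most k of the n values, which leaves two by the bound on n.\<close>

lemma ex_two_outside_range:
  fixes I :: "'k::finite \<Rightarrow> 'n::finite"
  assumes "CARD('n) \<ge> CARD('k) + 2"
  obtains a b where "a \<noteq> b" "a \<notin> range I" "b \<notin> range I"
proof -
  have "card (range I) \<le> CARD('k)"
    by (rule card_image_le) simp
  then have "2 \<le> card (- range I)"
    using assms by (simp add: Compl_eq_Diff_UNIV card_Diff_subset)
  then obtain T where "T \<subseteq> - range I" "card T = 2"
    by (rule obtain_subset_with_card_n)
  then obtain a b where "a \<noteq> b" "{a, b} \<subseteq> - range I"
    by (auto simp: card_2_iff)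
  then show thesis
    by (intro that[of a b]) blast+
qed

lemma ex_permutes_two_points:
  assumes "a \<noteq> b" "a' \<noteq> b'"
  obtains p where "p permutes UNIV" "p a' = a" "p b' = b"
proof
  \<comment> \<open>\<open>?q\<close> sends \<open>a'\<close> to \<open>a\<close>. The second
    transposition corrects the image of \<open>b'\<close> and does not move \<open>a\<close>, since
    \<open>?q b'\<close> and \<open>b\<close> both differ from \<open>a\<close>.\<close>
  let ?q = "Transposition.transpose a' a"
  show "Transposition.transpose (?q b') b \<circ> ?q permutes UNIV"
    by (intro permutes_compose permutes_swap_id) auto
  show "(Transposition.transpose (?q b') b \<circ> ?q) a' = a" "(Transposition.transpose (?q b') b \<circ> ?q) b' = b"
    using assms by (auto simp: Transposition.transpose_def)
qed

lemma perm_rep_transpose_eq_if_scales: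
  fixes x :: "'f::field ^ ('k::finite \<Rightarrow> 'n::finite)"
  assumes card: "CARD('n) \<ge> CARD('k) + 2" and x: "x \<noteq> 0"
    and scales: "\<And>p. p permutes UNIV \<Longrightarrow> \<exists>c. c \<noteq> 0 \<and> perm_rep p x = c *s x"
  shows "perm_rep (Transposition.transpose a b) x = x"
proof (cases "a = b")
  case True
  then show ?thesis by (simp add: perm_rep_id)
next
  case False
  obtain I where I: "x $ I \<noteq> 0"
    using x by (auto simp: vec_eq_iff)
  obtain a' b' where ab': "a' \<noteq> b'" "a' \<notin> range I" "b' \<notin> range I"
    using ex_two_outside_range[OF card] .
  have tr: "Transposition.transpose u v permutes UNIV" for u v :: 'n
    by (rule permutes_swap_id) auto
  have fixed: "perm_rep (Transposition.transpose a' b') x = x"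
  proof -
    obtain c where c: "perm_rep (Transposition.transpose a' b') x = c *s x"
      using scales[OF tr] by blast
    \<comment> \<open>A transposition is its own inverse, so coordinate \<open>I\<close> of the
      permuted tensor is \<open>x $ I\<close> itself; as this is nonzero, \<open>c\<close> must be
      1.\<close>
    have "Transposition.transpose a' b' \<circ> I = I"
      using ab' by (auto simp: fun_eq_iff Transposition.transpose_def)
    then have "x $ I = c * x $ I"
      using arg_cong[OF c, of "\<lambda>y. y $ I"] by (simp add: perm_rep_def)
    with I c show ?thesis by simp
  qed
  obtain p where p: "p permutes UNIV" "p a' = a" "p b' = b"
    using ex_permutes_two_points[OF False ab'(1)] .
  obtain c where c: "c \<noteq> 0" "perm_rep p x = c *s x"
    using scales[OF p(1)] by blast
  have "Hilbert_Choice.inv p a = a'" "Hilbert_Choice.inv p b = b'"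
    using p by (simp_all add: permutes_inv_eq[OF p(1)])
  \<comment> \<open>Conjugation by \<open>p\<close> carries the transposition known to fix
    \<open>x\<close> to the given one.\<close>
  then have "Transposition.transpose a b \<circ> p = p \<circ> Transposition.transpose a' b'"
    using transpose_comp_eq[OF permutes_bij[OF p(1)], of a b] by simp
  then have "perm_rep (Transposition.transpose a b) (perm_rep p x) = perm_rep p x"
    by (metis perm_rep_comp tr p(1) fixed)
  \<comment> \<open>Here \<open>perm_rep p x\<close> is \<open>c *s x\<close>, and the nonzero
    \<open>c\<close> cancels.\<close>
  then show ?thesis
    using c by (simp add: perm_rep_scale)
qed

lemma perm_rep_eq_if_transposes:
  fixes x :: "'f::field ^ ('k::finite \<Rightarrow> 'n::finite)"
  assumes "\<And>a b. perm_rep (Transposition.transpose a b) x = x" and "p permutes UNIV"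
  shows "perm_rep p x = x"
  using assms(2) finite
proof (induction rule: permutes_induct)
  case id
  show ?case by (rule perm_rep_id)
next
  case (swap a b p)
  then show ?case
    by (simp only: perm_rep_comp[OF permutes_swap_id[OF swap.hyps(1,2)] swap.hyps(4)] assms(1))
qed

text \<open>Stated over an arbitrary field, so that the real and complex cases are both
  instances.\<close>

lemma proj_invariant_iff_invariant:
  fixes x :: "'f::field ^ ('k::finite \<Rightarrow> 'n::finite)"
  assumes "CARD('n) \<ge> CARD('k) + 2" and "x \<noteq> 0"
  shows "(\<forall>p. p permutes UNIV \<longrightarrow> proj_act (proj_perm_rep p) (proj_class x) = proj_class x) \<longleftrightarrow>
    (\<forall>p. p permutes UNIV \<longrightarrow> perm_rep p x = x)"
proof
  assume "\<forall>p. p permutes UNIV \<longrightarrow> proj_act (proj_perm_rep p) (proj_class x) = proj_class x"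
  then have "\<exists>c. c \<noteq> 0 \<and> perm_rep p x = c *s x" if "p permutes UNIV" for p
    using that proj_perm_rep_fixes_iff[OF that \<open>x \<noteq> 0\<close>] by simp
  then show "\<forall>p. p permutes UNIV \<longrightarrow> perm_rep p x = x"
    using perm_rep_eq_if_transposes[OF perm_rep_transpose_eq_if_scales[OF assms]] by simp
next
  assume "\<forall>p. p permutes UNIV \<longrightarrow> perm_rep p x = x"
  then show "\<forall>p. p permutes UNIV \<longrightarrow> proj_act (proj_perm_rep p) (proj_class x) = proj_class x"
    \<comment> \<open>The scalar is 1.\<close>
    by (metis proj_perm_rep_fixes_iff[OF _ \<open>x \<noteq> 0\<close>] vec.scale_one zero_neq_one)
qed

theorem corollary1p18:
  assumes "CARD('n::finite) \<ge> CARD('k::finite) + 2"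
  shows "(\<forall>x :: real ^ ('k \<Rightarrow> 'n). x \<noteq> 0 \<longrightarrow>
           ((\<forall>\<pi>. \<pi> permutes UNIV \<longrightarrow> proj_act (proj_perm_rep \<pi>) (proj_class x) = proj_class x) \<longleftrightarrow>
            (\<forall>\<pi>. \<pi> permutes UNIV \<longrightarrow> perm_rep \<pi> x = x))) \<and>
         (\<forall>x :: complex ^ ('k \<Rightarrow> 'n). x \<noteq> 0 \<longrightarrow>
           ((\<forall>\<pi>. \<pi> permutes UNIV \<longrightarrow> proj_act (proj_perm_rep \<pi>) (proj_class x) = proj_class x) \<longleftrightarrow>
            (\<forall>\<pi>. \<pi> permutes UNIV \<longrightarrow> perm_rep \<pi> x = x)))"
  by (intro conjI allI impI proj_invariant_iff_invariant assms)

end
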